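(* Let $\nu$ be a compactly supported Borel probability measure on $\mathbb{R}^d$. Then the map $r\mapsto\overline{D}_{r}(\nu)$ is continuous on $(0,\infty)$.
   Context: For $r>0$ and $n\in\mathbb{N}$ let $\mathfrak{e}_{n,r}(\nu)=\inf\left\{\left(\int d(x,\alpha)^r\,d\nu(x)\right)^{1/r}:\alpha\subset\mathbb{R}^d,\ 1\le\mathrm{card}(\alpha)\le n\right\}$ with $d(x,\alpha)=\min_{y\in\alpha}\|x-y\|$. The upper quantization dimension of order $r$ is $\overline{D}_r(\nu)=\limsup_{n\to\infty}\frac{\log n}{-\log\mathfrak{e}_{n,r}(\nu)}$ (the quotient is $0$ if $\mathfrak{e}_{n,r}(\nu)=0$). *)

theory Defs
  imports "HOL-Probability.Probability"
begin

definition measure_support :: "'a::topological_space measure \<Rightarrow> 'a set" where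
  "measure_support M = {x. \<forall>U. open U \<and> x \<in> U \<longrightarrow> emeasure M U > 0}"

definition dist_to_finite :: "'a::real_normed_vector \<Rightarrow> 'a set \<Rightarrow> real" where
  "dist_to_finite x A = Min ((\<lambda>y. norm (x - y)) ` A)"

(* The Bochner integral is 0 for non-integrable functions, so this is the usual quantization
   error only for measures with finite r-th moment, in particular for every compactly supported
   probability measure.  The condition 1 \<le> card A forces A to be finite and nonempty. *)
definition quantization_error :: "'a::real_normed_vector measure \<Rightarrow> real \<Rightarrow> nat \<Rightarrow> real" where
  "quantization_error M r n =
     Inf {(\<integral>x. dist_to_finite x A powr r \<partial>M) powr (1 / r) | A. 1 \<le> card A \<and> card A \<le> n}"

(* The limsup is taken in the extended reals, so no boundedness is presupposed.  If an error
   equals 1, the quotient is 0 by the convention x / 0 = 0; for a measure with finite r-th moment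
   on a Euclidean space the errors tend to 0, so this does not affect the limsup. *)
definition upper_quantization_dim :: "'a::real_normed_vector measure \<Rightarrow> real \<Rightarrow> ereal" where
  "upper_quantization_dim M r =
     limsup (\<lambda>n. ereal (if quantization_error M r n = 0 then 0
                        else ln (real n) / (- ln (quantization_error M r n))))"

end

theory Submission
  imports Defs
begin

text \<open>On a set carrying the measure, the distance to a good codebook is bounded by a constant
  \<open>C\<close> independent of the codebook, so \<open>d\<^sup>s \<le> C\<^bsup>s-r\<^esup> d\<^sup>r\<close> for \<open>r < s\<close>, and hence
  \<open>e\<^sub>s \<le> C\<^bsup>1-r/s\<^esup> e\<^sub>r\<^bsup>r/s\<^esup>\<close> for the quantization errors of level \<open>n\<close>. Conversely
  \<open>e\<^sub>r \<le> e\<^sub>s\<close>, since the \<open>L\<^sup>p\<close> norms of a probability measure increase in the exponent. As the errors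
  tend to \<open>0\<close>, the constant disappears in the limit and \<open>D\<^sub>r \<le> D\<^sub>s \<le> (s/r) D\<^sub>r\<close>, which forces
  continuity.\<close>

section \<open>Support of a measure and monotonicity of L^p norms\<close>

text \<open>Second countability: every point outside the support lies in a null set of a countable
  basis, and countably many null sets have a null union.\<close>

lemma AE_in_measure_support:
  fixes M :: "'a::second_countable_topology measure"
  assumes "sets M = sets borel"
  shows "AE x in M. x \<in> measure_support M"
proof -
  obtain B :: "'a set set" where B: "countable B" "topological_basis B"
    using ex_countable_basis by blast
  let ?N = "{U \<in> B. emeasure M U = 0}"
  have op: "open U" if "U \<in> B" for U
    using B(2) that by (rule topological_basis_open)
  have "(\<Union>U\<in>?N. U) \<in> null_sets M"
  proof (rule null_sets_UN')
    show "countable ?N" using B(1) by simp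
    show "U \<in> null_sets M" if "U \<in> ?N" for U
      using that op assms by (auto simp: null_sets_def)
  qed
  moreover have "{x \<in> space M. x \<notin> measure_support M} \<subseteq> (\<Union>U\<in>?N. U)"
  proof
    fix x assume "x \<in> {x \<in> space M. x \<notin> measure_support M}"
    then obtain V where V: "open V" "x \<in> V" "emeasure M V = 0"
      by (auto simp: measure_support_def)
    obtain U where U: "U \<in> B" "x \<in> U" "U \<subseteq> V"
      using topological_basisE[OF B(2) V(1,2)] by blast
    have "emeasure M U \<le> emeasure M V"
      using U(3) V(1) assms by (intro emeasure_mono) auto
    then show "x \<in> (\<Union>U\<in>?N. U)" using U V by auto
  qed
  ultimately show ?thesis by (auto intro: AE_I')
qed

lemma dist_to_finite_eq_infdist:
  assumes "finite A" "A \<noteq> {}"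
  shows "dist_to_finite x A = infdist x A"
  using assms by (simp add: dist_to_finite_def infdist_def dist_norm cInf_eq_Min)

lemma card_ge_1D:
  assumes "1 \<le> card A"
  shows "finite A" "A \<noteq> {}"
  using assms by (metis card.infinite not_one_le_zero) (use assms in auto)

text \<open>Normalize \<open>f x powr r\<close> by its mean \<open>m\<close>, apply Young's
  inequality pointwise with second factor 1, and integrate. If \<open>m = 0\<close>, the left side
  is 0.\<close>

lemma (in prob_space) L_norm_mono:
  fixes f :: "'a \<Rightarrow> real"
  assumes rs: "0 < r" "r < s" and f: "\<And>x. 0 \<le> f x"
    and int: "integrable M (\<lambda>x. f x powr r)" "integrable M (\<lambda>x. f x powr s)"
  shows "(\<integral>x. f x powr r \<partial>M) powr (1 / r) \<le> (\<integral>x. f x powr s \<partial>M) powr (1 / s)"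
proof (cases "(\<integral>x. f x powr r \<partial>M) = 0")
  case False
  define m where "m = (\<integral>x. f x powr r \<partial>M)"
  define p where "p = s / r"
  have m: "0 < m"
    using False by (simp add: m_def less_le)
  have p: "1 < p" using rs by (simp add: p_def)
  have pw: "(f x powr r / m) powr p = f x powr s / m powr p" for x
    using f rs m by (simp add: powr_divide powr_powr p_def)
  have "f x powr r / m \<le> f x powr s / m powr p / p + (1 - 1 / p)" for x
  proof -
    \<comment> \<open>The exponents are \<open>p = s / r\<close> and its conjugate
      \<open>p / (p - 1)\<close>. After integration the left side is 1 and the constant
      \<open>1 - 1 / p\<close> cancels.\<close>
    have "f x powr r / m * 1 \<le> (f x powr r / m) powr p / p + 1 powr (p / (p - 1)) / (p / (p - 1))"
      using p m f by (intro Youngs_inequality) (auto simp: field_simps)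
    then show ?thesis using p unfolding pw by (simp add: field_simps)
  qed
  then have "(\<integral>x. f x powr r / m \<partial>M) \<le> (\<integral>x. f x powr s / m powr p / p + (1 - 1 / p) \<partial>M)"
    using int by (intro integral_mono) auto
  also have "\<dots> = (\<integral>x. f x powr s \<partial>M) / m powr p / p + (1 - 1 / p)"
    using int by (simp add: prob_space)
  finally have "1 \<le> (\<integral>x. f x powr s \<partial>M) / m powr p"
    using m p by (simp add: m_def[symmetric] field_simps)
  then have "m powr p \<le> (\<integral>x. f x powr s \<partial>M)"
    using m by (simp add: field_simps)
  then have "(m powr p) powr (1 / s) \<le> (\<integral>x. f x powr s \<partial>M) powr (1 / s)"
    using rs by (intro powr_mono2) auto
  then show ?thesis
    using rs by (simp add: powr_powr p_def m_def)
qed auto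

section \<open>Quantization errors of a measure carried by a compact set\<close>

locale compactly_supported = prob_space M
  for M :: "'a::euclidean_space measure" +
  fixes K :: "'a set"
  assumes sets_M: "sets M = sets borel"
    and compact_K: "compact K"
    and AE_K: "AE x in M. x \<in> K"
begin

lemma infdist_powr_measurable: "(\<lambda>x. infdist x A powr r) \<in> borel_measurable M"
proof -
  have "(\<lambda>x. infdist x A) \<in> borel_measurable borel"
    by (intro borel_measurable_continuous_onI continuous_on_infdist continuous_on_id)
  then show ?thesis
    unfolding measurable_cong_sets[OF sets_M refl] by measurable
qed

text \<open>The oscillation bound is the same for all \<open>A\<close>, so one point of
  \<open>K\<close> near a codebook controls its distance to all of \<open>K\<close>.\<close>

lemma infdist_bounded_on_K:
  assumes "x \<in> K" "y \<in> K"
  shows "infdist y A \<le> infdist x A + diameter K"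
proof -
  have "infdist y A \<le> infdist x A + dist y x" by (rule infdist_triangle)
  also have "dist y x \<le> diameter K"
    using assms compact_K by (intro diameter_bounded_bound compact_imp_bounded)
  finally show ?thesis by simp
qed

lemma K_nonempty: "K \<noteq> {}"
  using AE_K AE_False by auto

lemma infdist_powr_integrable:
  assumes "0 < r"
  shows "integrable M (\<lambda>x. infdist x A powr r)"
proof -
  obtain x where x: "x \<in> K" using K_nonempty by auto
  show ?thesis
  proof (rule integrable_const_bound[OF _ infdist_powr_measurable])
    show "AE y in M. norm (infdist y A powr r) \<le> (infdist x A + diameter K) powr r"
      using AE_K by eventually_elim
        (use assms infdist_bounded_on_K[OF x] in \<open>auto intro!: powr_mono2 infdist_nonneg\<close>)
  qed
qed

lemma quantization_error_infdist:
  "quantization_error M r n =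
     Inf {(\<integral>x. infdist x A powr r \<partial>M) powr (1 / r) | A. 1 \<le> card A \<and> card A \<le> n}"
proof -
  have "(\<integral>x. dist_to_finite x A powr r \<partial>M) = (\<integral>x. infdist x A powr r \<partial>M)" if "1 \<le> card A" for A
    by (simp only: dist_to_finite_eq_infdist[OF card_ge_1D[OF that]])
  then show ?thesis
    unfolding quantization_error_def by (intro arg_cong[where f = Inf] Collect_cong) metis
qed

lemma quantization_error_le:
  assumes "1 \<le> card A" "card A \<le> n"
  shows "quantization_error M r n \<le> (\<integral>x. infdist x A powr r \<partial>M) powr (1 / r)"
  unfolding quantization_error_infdist
  using assms by (intro cInf_lower) (auto intro!: bdd_belowI[of _ 0])

lemma codebooks_nonempty:
  assumes "1 \<le> n"
  shows "{(\<integral>x. infdist x A powr r \<partial>M) powr (1 / r) | A. 1 \<le> card A \<and> card A \<le> n} \<noteq> {}"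
  using assms by (auto intro!: exI[of _ "{0}"])

lemma quantization_error_nonneg:
  assumes "1 \<le> n"
  shows "0 \<le> quantization_error M r n"
  unfolding quantization_error_infdist
  using codebooks_nonempty[OF assms] by (rule cInf_greatest) auto

text \<open>Supplies near-optimal codebooks; estimates are made for these and then passed to the
  infimum.\<close>

lemma quantization_error_lessE:
  assumes "1 \<le> n" "quantization_error M r n < z"
  obtains A where "1 \<le> card A" "card A \<le> n" "(\<integral>x. infdist x A powr r \<partial>M) powr (1 / r) < z"
  using cInf_lessD[OF codebooks_nonempty[OF assms(1)]] assms(2)
  unfolding quantization_error_infdist by blast

lemma quantization_error_mono:
  assumes "0 < r" "r < s" "1 \<le> n"
  shows "quantization_error M r n \<le> quantization_error M s n"
proof (rule field_le_epsilon)
  fix e :: real assume "0 < e"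
  then obtain A where A: "1 \<le> card A" "card A \<le> n"
    "(\<integral>x. infdist x A powr s \<partial>M) powr (1 / s) < quantization_error M s n + e"
    using quantization_error_lessE[OF assms(3), of s "quantization_error M s n + e"] by auto
  have "quantization_error M r n \<le> (\<integral>x. infdist x A powr r \<partial>M) powr (1 / r)"
    using A by (intro quantization_error_le)
  also have "\<dots> \<le> (\<integral>x. infdist x A powr s \<partial>M) powr (1 / s)"
    using assms by (intro L_norm_mono infdist_powr_integrable infdist_nonneg) auto
  finally show "quantization_error M r n \<le> quantization_error M s n + e"
    using A(3) by simp
qed

text \<open>A finite \<open>e / 2\<close>-net of \<open>K\<close> is an admissible codebook for
  every \<open>n\<close> beyond its cardinality; halving the radius makes the inequality
  strict.\<close>

lemma quantization_error_eventually_less: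
  assumes r: "0 < r" and e: "0 < e"
  shows "eventually (\<lambda>n. quantization_error M r n < e) sequentially"
proof -
  obtain A where A: "finite A" "A \<subseteq> K" "K \<subseteq> (\<Union>x\<in>A. ball x (e / 2))"
    using compactE_image[OF compact_K, of K "\<lambda>x. ball x (e / 2)"] e by (metis (no_types, lifting)
      UN_I centre_in_ball half_gt_zero open_ball subsetI)
  have ne: "A \<noteq> {}" using A(3) K_nonempty by auto
  have card: "1 \<le> card A" using A(1) ne by (simp add: Suc_leI card_gt_0_iff)
  have bound: "infdist x A powr r \<le> (e / 2) powr r" if x: "x \<in> K" for x
  proof -
    obtain a where "a \<in> A" "x \<in> ball a (e / 2)" using A(3) x by blast
    then have "infdist x A \<le> e / 2" using infdist_le[of a A x] by (simp add: dist_commute)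
    then show ?thesis using r by (intro powr_mono2 infdist_nonneg) auto
  qed
  have "(\<integral>x. infdist x A powr r \<partial>M) \<le> (\<integral>x. (e / 2) powr r \<partial>M)"
  proof (rule integral_mono_AE[OF infdist_powr_integrable[OF r]])
    show "AE x in M. infdist x A powr r \<le> (e / 2) powr r"
      using AE_K by eventually_elim (rule bound)
  qed auto
  then have "(\<integral>x. infdist x A powr r \<partial>M) powr (1 / r) \<le> ((e / 2) powr r) powr (1 / r)"
    using r by (intro powr_mono2) (auto simp: prob_space)
  also have "\<dots> < e" using r e by (simp add: powr_powr)
  finally have "quantization_error M r n < e" if "card A \<le> n" for n
    using quantization_error_le[OF card that, of r] by simp
  then show ?thesis by (rule eventually_sequentiallyI)
qed

text \<open>An error below 1 forces some point of \<open>K\<close> within distance 1 of the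
  codebook. All of \<open>K\<close> is then within \<open>1 + diameter K\<close>, which bounds the
  surplus factor of exponent \<open>s - r\<close>.\<close>

lemma quantization_error_powr_bound:
  assumes rs: "0 < r" "r < s" and n: "1 \<le> n" and less: "quantization_error M r n < 1"
  shows "quantization_error M s n
    \<le> (1 + diameter K) powr ((s - r) / s) * quantization_error M r n powr (r / s)"
proof -
  let ?C = "1 + diameter K" and ?e = "quantization_error M r n"
  have C: "1 \<le> ?C"
    using compact_K by (simp add: diameter_ge_0 compact_imp_bounded)
  \<comment> \<open>The infimum may not be attained, so the estimate is made at each level
    \<open>z\<close> strictly between the error and 1; \<open>z\<close> decreases to the error at
    the end.\<close>
  have bound: "quantization_error M s n \<le> ?C powr ((s - r) / s) * z powr (r / s)"
    if z: "?e < z" "z < 1" for z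
  proof -
    obtain A where A: "1 \<le> card A" "card A \<le> n"
      and Az: "(\<integral>x. infdist x A powr r \<partial>M) powr (1 / r) < z"
      using quantization_error_lessE[OF n z(1)] by blast
    let ?m = "\<integral>x. infdist x A powr r \<partial>M"
    have m0: "0 \<le> ?m" by (intro integral_nonneg_AE) auto
    have z0: "0 < z" using Az by (meson le_less_trans powr_ge_zero)
    have "?m = (?m powr (1 / r)) powr r" using rs m0 by (simp add: powr_powr)
    also have "\<dots> \<le> z powr r" using Az rs by (intro powr_mono2) auto
    finally have mz: "?m \<le> z powr r" .
    also have "\<dots> < 1" using z z0 rs powr_less_mono2[of r z 1] by simp
    finally have m1: "?m < 1" .
    \<comment> \<open>Otherwise the integrand is at least 1 almost everywhere, against
      \<open>?m < 1\<close>.\<close>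
    have "\<exists>x\<in>K. infdist x A \<le> 1"
    proof (rule ccontr)
      assume "\<not> ?thesis"
      then have *: "AE x in M. 1 \<le> infdist x A powr r"
        using AE_K by (auto elim!: eventually_mono intro!: ge_one_powr_ge_zero simp: rs less_imp_le)
      have "(\<integral>x. 1 \<partial>M) \<le> ?m"
        by (rule integral_mono_AE[OF _ infdist_powr_integrable[OF rs(1)] *]) auto
      then show False using m1 by (simp add: prob_space)
    qed
    then obtain x where x: "x \<in> K" "infdist x A \<le> 1" ..
    have le_C: "infdist y A \<le> ?C" if "y \<in> K" for y
      using infdist_bounded_on_K[OF x(1) that, of A] x(2) by simp
    have "(\<integral>x. infdist x A powr s \<partial>M) \<le> (\<integral>x. ?C powr (s - r) * infdist x A powr r \<partial>M)"
    proof (rule integral_mono_AE)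
      show "AE x in M. infdist x A powr s \<le> ?C powr (s - r) * infdist x A powr r"
        using AE_K
      proof eventually_elim
        fix x assume "x \<in> K"
        have "infdist x A powr s = infdist x A powr (s - r) * infdist x A powr r"
          by (simp flip: powr_add)
        also have "\<dots> \<le> ?C powr (s - r) * infdist x A powr r"
          using le_C[OF \<open>x \<in> K\<close>] rs by (intro mult_right_mono powr_mono2 infdist_nonneg) auto
        finally show "infdist x A powr s \<le> ?C powr (s - r) * infdist x A powr r" .
      qed
    qed (use rs in \<open>auto intro!: infdist_powr_integrable\<close>)
    also have "\<dots> = ?C powr (s - r) * ?m" by simp
    also have "\<dots> \<le> ?C powr (s - r) * z powr r" using mz by (intro mult_left_mono) auto
    finally have "(\<integral>x. infdist x A powr s \<partial>M) powr (1 / s)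
        \<le> (?C powr (s - r) * z powr r) powr (1 / s)"
      using rs by (intro powr_mono2) auto
    also have "\<dots> = ?C powr ((s - r) / s) * z powr (r / s)"
      by (simp add: powr_mult powr_powr)
    finally show ?thesis using quantization_error_le[OF A, of s] by simp
  qed
  show ?thesis
  proof (rule tendsto_lowerbound)
    \<comment> \<open>The limit base \<open>?e\<close> may be 0; continuity from the right there
      rests on \<open>r / s > 0\<close> and on \<open>z\<close> being nonnegative.\<close>
    show "((\<lambda>z. ?C powr ((s - r) / s) * z powr (r / s)) \<longlongrightarrow>
        ?C powr ((s - r) / s) * ?e powr (r / s)) (at_right ?e)"
      using rs quantization_error_nonneg[OF n, of r]
      by (intro tendsto_intros tendsto_powr2)
        (auto simp: eventually_at_right_field intro!: exI[of _ "?e + 1"])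
    show "eventually (\<lambda>z. quantization_error M s n \<le> ?C powr ((s - r) / s) * z powr (r / s))
        (at_right ?e)"
      unfolding eventually_at_right_field using less bound by blast
  qed simp
qed

section \<open>Comparison of upper quantization dimensions of different orders\<close>

text \<open>Used with bounds at most 1: nonzero errors then have negative logarithm, and the
  quotient never meets division by \<open>ln 1 = 0\<close>.\<close>

lemma quantization_error_good:
  assumes "0 < r" "0 < e"
  shows "eventually (\<lambda>n. 1 \<le> n \<and> 0 \<le> quantization_error M r n \<and> quantization_error M r n < e)
    sequentially"
  using quantization_error_eventually_less[OF assms] eventually_ge_at_top[of 1]
  by eventually_elim (auto simp: quantization_error_nonneg)

lemma upper_quantization_dim_nonneg:
  assumes r: "0 < r"
  shows "0 \<le> upper_quantization_dim M r"
  unfolding upper_quantization_dim_def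
proof (rule le_Limsup[OF sequentially_bot])
  show "\<forall>\<^sub>F n in sequentially. 0 \<le> ereal (if quantization_error M r n = 0 then 0
      else ln (real n) / (- ln (quantization_error M r n)))"
    using quantization_error_good[OF r zero_less_one]
    by eventually_elim (auto intro!: divide_nonneg_neg)
qed

lemma upper_quantization_dim_mono:
  assumes rs: "0 < r" "r < s"
  shows "upper_quantization_dim M r \<le> upper_quantization_dim M s"
  unfolding upper_quantization_dim_def
proof (rule Limsup_mono)
  have s: "0 < s" using rs by simp
  show "\<forall>\<^sub>F n in sequentially. ereal (if quantization_error M r n = 0 then 0
      else ln (real n) / (- ln (quantization_error M r n)))
    \<le> ereal (if quantization_error M s n = 0 then 0
      else ln (real n) / (- ln (quantization_error M s n)))"
    using quantization_error_good[OF rs(1) zero_less_one] quantization_error_good[OF s zero_less_one]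
  proof eventually_elim
    case (elim n)
    let ?a = "quantization_error M r n" and ?b = "quantization_error M s n"
    have ab: "?a \<le> ?b" using quantization_error_mono[OF rs] elim by auto
    show ?case
    proof (cases "?a = 0")
      case True
      \<comment> \<open>The left quotient has the conventional value 0, and the right one is
        nonnegative.\<close>
      then show ?thesis using elim by (auto intro!: divide_nonneg_neg)
    next
      case False
      then have "ln (real n) / (- ln ?a) \<le> ln (real n) / (- ln ?b)"
        using elim ab by (intro divide_left_mono mult_pos_pos) auto
      then show ?thesis using False elim ab by auto
    qed
  qed
qed

text \<open>Taking logarithms in \<open>quantization_error_powr_bound\<close> leaves an additive
  constant. The slack between \<open>l\<close> and \<open>s / r\<close> absorbs it once the error of
  order \<open>r\<close> is small.\<close>

lemma upper_quantization_dim_le_mult: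
  assumes rs: "0 < r" "r < s" and l: "s / r < l"
  shows "upper_quantization_dim M s \<le> ereal l * upper_quantization_dim M r"
proof -
  have s: "0 < s" using rs by simp
  have l0: "0 < l" using l rs by (meson divide_pos_pos less_trans)
  \<comment> \<open>\<open>c\<close> is the logarithm of the constant factor, and \<epsilon> is the
    share of the coefficient \<open>r / s\<close> of \<open>ln ?a\<close> that can be spent on it,
    leaving \<open>1 / l\<close>.\<close>
  define c where "c = (s - r) / s * ln (1 + diameter K)"
  define \<epsilon> where "\<epsilon> = r / s - 1 / l"
  have \<epsilon>: "0 < \<epsilon>" using l rs l0 by (simp add: \<epsilon>_def field_simps)
  have C: "1 \<le> 1 + diameter K"
    using compact_K by (simp add: diameter_ge_0 compact_imp_bounded)
  \<comment> \<open>Below \<open>exp (- c / \<epsilon>)\<close> the sum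
    \<open>c + \<epsilon> * ln ?a\<close> is negative; the minimum with 1 keeps \<open>ln ?a\<close>
    negative.\<close>
  define \<delta> where "\<delta> = min 1 (exp (- c / \<epsilon>))"
  have \<delta>: "0 < \<delta>" by (simp add: \<delta>_def)
  have "\<forall>\<^sub>F n in sequentially.
      ereal (if quantization_error M s n = 0 then 0
        else ln (real n) / (- ln (quantization_error M s n)))
      \<le> ereal l * ereal (if quantization_error M r n = 0 then 0
        else ln (real n) / (- ln (quantization_error M r n)))"
    using quantization_error_good[OF rs(1) \<delta>] quantization_error_good[OF s zero_less_one]
  proof eventually_elim
    case (elim n)
    let ?a = "quantization_error M r n" and ?b = "quantization_error M s n"
    have a1: "?a < 1" and ac: "?a < exp (- c / \<epsilon>)" using elim by (auto simp: \<delta>_def)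
    have ab: "?b \<le> (1 + diameter K) powr ((s - r) / s) * ?a powr (r / s)"
      using quantization_error_powr_bound[OF rs] elim a1 by auto
    have "0 \<le> l * (ln (real n) / (- ln ?a))" if "?a \<noteq> 0"
      using elim that a1 l0 by (intro mult_nonneg_nonneg divide_nonneg_pos) auto
    moreover have "ln (real n) / (- ln ?b) \<le> l * (ln (real n) / (- ln ?a))"
      if nz: "?a \<noteq> 0" "?b \<noteq> 0"
    proof -
      have a: "0 < ?a" and b: "0 < ?b" using elim nz by auto
      have "ln ?b \<le> ln ((1 + diameter K) powr ((s - r) / s) * ?a powr (r / s))"
        using ab b a C by (subst ln_le_cancel_iff) auto
      also have "\<dots> = c + r / s * ln ?a"
        using a C by (simp add: ln_mult ln_powr c_def)
      finally have 1: "ln ?b \<le> c + r / s * ln ?a" .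
      have "ln ?a < - c / \<epsilon>" using ac a by (metis exp_less_cancel_iff exp_ln)
      then have "c + \<epsilon> * ln ?a < 0" using \<epsilon> by (simp add: field_simps)
      with 1 have 2: "ln ?b \<le> 1 / l * ln ?a" by (simp add: \<epsilon>_def algebra_simps)
      have la: "ln ?a < 0" using a a1 by simp
      have "ln (real n) / (- ln ?b) \<le> ln (real n) / (- (1 / l * ln ?a))"
      proof (rule divide_left_mono)
        have "1 / l * ln ?a < 0" using la l0 by (simp add: field_simps)
        then show "0 < - ln ?b * - (1 / l * ln ?a)" using 2 by (intro mult_pos_pos) auto
      qed (use 2 elim in auto)
      then show ?thesis using l0 by (simp add: mult.commute)
    qed
    \<comment> \<open>Here the power bound is 0, so both quotients take the conventional value
      0.\<close>
    moreover have "?b = 0" if "?a = 0"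
      using ab that elim by auto
    ultimately show ?case
      unfolding times_ereal.simps ereal_less_eq(3)
      by (cases "?a = 0"; cases "?b = 0") simp_all
  qed
  then have "upper_quantization_dim M s \<le>
      limsup (\<lambda>n. ereal l * ereal (if quantization_error M r n = 0 then 0
        else ln (real n) / (- ln (quantization_error M r n))))"
    unfolding upper_quantization_dim_def by (rule Limsup_mono)
  also have "\<dots> = ereal l * upper_quantization_dim M r"
    unfolding upper_quantization_dim_def using l0 by (intro limsup_ereal_mult_left) simp
  finally show ?thesis .
qed

text \<open>The square makes the factor strictly larger than the quotient of the exponents, as
  \<open>upper_quantization_dim_le_mult\<close> requires.\<close>

lemma upper_quantization_dim_sandwich:
  assumes "0 < r" "0 < s"
  shows "ereal (min 1 ((s / r)\<^sup>2)) * upper_quantization_dim M r \<le> upper_quantization_dim M s"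
    and "upper_quantization_dim M s \<le> ereal (max 1 ((s / r)\<^sup>2)) * upper_quantization_dim M r"
proof -
  let ?D = "upper_quantization_dim M"
  have sq: "t / u < (t / u)\<^sup>2" if "0 < u" "u < t" for t u :: real
    using that by (simp add: power2_eq_square field_simps)
  consider "s < r" | "s = r" | "r < s" by linarith
  then have "ereal (min 1 ((s / r)\<^sup>2)) * ?D r \<le> ?D s \<and> ?D s \<le> ereal (max 1 ((s / r)\<^sup>2)) * ?D r"
  proof cases
    case 1
    then have q: "(s / r)\<^sup>2 \<le> 1" using assms by (intro power_le_one) auto
    \<comment> \<open>For \<open>s < r\<close> the roles of the exponents are swapped; multiplying
      by the reciprocal square turns this into the lower bound, while monotonicity gives the upper
      one.\<close>
    have "?D r \<le> ereal ((r / s)\<^sup>2) * ?D s"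
      using upper_quantization_dim_le_mult[OF assms(2) 1 sq[OF assms(2) 1]] .
    then have "ereal ((s / r)\<^sup>2) * ?D r \<le> ereal ((s / r)\<^sup>2) * (ereal ((r / s)\<^sup>2) * ?D s)"
      by (intro ereal_mult_left_mono) auto
    also have "\<dots> = ?D s"
      using assms by (simp flip: mult.assoc power_mult_distrib)
    finally show ?thesis
      using q upper_quantization_dim_mono[OF assms(2) 1]
      by (simp add: min_absorb2 max_absorb1 flip: one_ereal_def)
  next
    case 2
    then show ?thesis using assms by (simp flip: one_ereal_def)
  next
    case 3
    then have q: "1 \<le> (s / r)\<^sup>2" using assms by (intro one_le_power) auto
    show ?thesis
      using q upper_quantization_dim_mono[OF assms(1) 3]
        upper_quantization_dim_le_mult[OF assms(1) 3 sq[OF assms(1) 3]]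
      by (simp add: min_absorb1 max_absorb2 flip: one_ereal_def)
  qed
  then show "ereal (min 1 ((s / r)\<^sup>2)) * ?D r \<le> ?D s"
    and "?D s \<le> ereal (max 1 ((s / r)\<^sup>2)) * ?D r" by auto
qed

section \<open>Continuity in the order\<close>

text \<open>Squeeze: both factors of the sandwich tend to 1 as \<open>s\<close> tends to
  \<open>r\<close>. An infinite value is treated apart.\<close>

lemma continuous_on_upper_quantization_dim:
  "continuous_on {0<..} (\<lambda>r. upper_quantization_dim M r)"
  unfolding continuous_on_def
proof
  fix r :: real assume "r \<in> {0<..}"
  then have r: "0 < r" by simp
  let ?D = "upper_quantization_dim M"
  let ?F = "at r within {0<..}"
  have pos: "\<forall>\<^sub>F s in ?F. 0 < s"
    by (simp add: eventually_at_filter)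
  show "(?D \<longlongrightarrow> ?D r) ?F"
  proof (cases "?D r = \<infinity>")
    case True
    \<comment> \<open>A positive multiple of \<infinity> is \<infinity>, so the lower bound makes
      the dimension infinite at every positive order.\<close>
    have "\<forall>\<^sub>F s in ?F. ?D s = ?D r"
      using pos
    proof eventually_elim
      case (elim s)
      define c where "c = min 1 ((s / r)\<^sup>2)"
      have "0 < c" using r elim by (simp add: c_def)
      then have "ereal c * ?D r = \<infinity>" unfolding True by simp
      then show ?case using upper_quantization_dim_sandwich(1)[OF r elim] True by (simp add: c_def)
    qed
    then show ?thesis by (rule tendsto_eventually)
  next
    case False
    then obtain d where d: "?D r = ereal d"
      using upper_quantization_dim_nonneg[OF r] by (cases "?D r") auto
    \<comment> \<open>\<open>g\<close> stands for \<open>min\<close> and \<open>max\<close>, so that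
      one argument serves both sides of the squeeze.\<close>
    have lim: "((\<lambda>s. ereal (g 1 ((s / r)\<^sup>2) * d)) \<longlongrightarrow> ereal d) ?F"
      if g: "((\<lambda>s. g 1 ((s / r)\<^sup>2)) \<longlongrightarrow> g 1 ((r / r)\<^sup>2)) ?F" "g 1 1 = 1"
      for g :: "real \<Rightarrow> real \<Rightarrow> real"
    proof -
      have "((\<lambda>s. ereal (g 1 ((s / r)\<^sup>2) * d)) \<longlongrightarrow> ereal (g 1 ((r / r)\<^sup>2) * d)) ?F"
        by (intro tendsto_intros g)
      then show ?thesis using r g(2) by simp
    qed
    show ?thesis
      unfolding d
    proof (rule tendsto_sandwich)
      show "((\<lambda>s. ereal (min 1 ((s / r)\<^sup>2) * d)) \<longlongrightarrow> ereal d) ?F"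
        using r by (intro lim tendsto_intros) auto
      show "((\<lambda>s. ereal (max 1 ((s / r)\<^sup>2) * d)) \<longlongrightarrow> ereal d) ?F"
        using r by (intro lim tendsto_intros) auto
      show "\<forall>\<^sub>F s in ?F. ereal (min 1 ((s / r)\<^sup>2) * d) \<le> ?D s"
        using pos by eventually_elim
          (rule upper_quantization_dim_sandwich(1)[OF r, unfolded d times_ereal.simps])
      show "\<forall>\<^sub>F s in ?F. ?D s \<le> ereal (max 1 ((s / r)\<^sup>2) * d)"
        using pos by eventually_elim
          (rule upper_quantization_dim_sandwich(2)[OF r, unfolded d times_ereal.simps])
    qed
  qed
qed

end

theorem corollary1p5:
  fixes \<nu> :: "(real ^ 'd) measure"
  assumes "prob_space \<nu>"
    and "sets \<nu> = sets borel"
    and "compact (measure_support \<nu>)"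
  shows "continuous_on {0<..} (\<lambda>r. upper_quantization_dim \<nu> r)"
proof -
  interpret prob_space \<nu> by fact
  interpret compactly_supported \<nu> "measure_support \<nu>"
    using assms(2,3) by unfold_locales (auto intro: AE_in_measure_support)
  show ?thesis by (rule continuous_on_upper_quantization_dim)
qed

end
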